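(* Let $b\geq 2$ be an integer, and let $G = 2K_2\,\nabla\, K_b$ and $G' = 2K_2\,\nabla\, bK_1$, both graphs of order $n=b+4$. Then $G$ and $G'$ are $\mathcal{L}$-noncospectral and have the same normalized Laplacian energy. Furthermore, $$E_{\mathcal{L}}(G)=E_{\mathcal{L}}(G')=\frac{2b+4}{b+1}.$$
   Context: All graphs are finite, undirected, without loops or multiple edges. $K_m$ is the complete graph on $m$ vertices; $mH$ denotes the disjoint union of $m$ copies of a graph $H$; the join $G_1\nabla G_2$ is the graph obtained from the disjoint union of $G_1$ and $G_2$ by joining every vertex of $G_1$ to every vertex of $G_2$. For a graph without isolated vertices, the normalized Laplacian matrix is $\mathcal{L}=D^{-1/2}(D-A)D^{-1/2}$, where $A$ is the adjacency matrix and $D$ the diagonal degree matrix. If $\lambda_1,\dots,\lambda_n$ are the eigenvalues of $\mathcal{L}$ (with multiplicity) for a graph $G$ of order $n$, the normalized Laplacian energy is $E_{\mathcal{L}}(G)=\sum_{i=1}^n|\lambda_i-1|$. Two graphs are $\mathcal{L}$-noncospectral if their normalized Laplacian spectra (as multisets) are different. *)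

theory Defs
  imports "Jordan_Normal_Form.Char_Poly"
begin

record 'v ugraph =
  verts :: "'v set"
  edges :: "'v set set"

definition simple_graph :: "'v ugraph \<Rightarrow> bool" where
  "simple_graph G \<longleftrightarrow> finite (verts G) \<and> (\<forall>e\<in>edges G. e \<subseteq> verts G \<and> card e = 2)"

definition vdegree :: "'v ugraph \<Rightarrow> 'v \<Rightarrow> nat" where
  "vdegree G v = card {e \<in> edges G. v \<in> e}"

definition complete_graph :: "nat \<Rightarrow> nat ugraph" where
  "complete_graph m = \<lparr>verts = {..<m}, edges = {{i, j} |i j. i < m \<and> j < m \<and> i \<noteq> j}\<rparr>"

definition copies :: "nat \<Rightarrow> 'v ugraph \<Rightarrow> (nat \<times> 'v) ugraph" where
  "copies m H = \<lparr>verts = {..<m} \<times> verts H,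
                 edges = {Pair k ` e |k e. k < m \<and> e \<in> edges H}\<rparr>"

definition graph_join :: "'v ugraph \<Rightarrow> 'w ugraph \<Rightarrow> ('v + 'w) ugraph" where
  "graph_join G H = \<lparr>verts = verts G <+> verts H,
     edges = (`) Inl ` edges G \<union> (`) Inr ` edges H
             \<union> {{Inl v, Inr w} |v w. v \<in> verts G \<and> w \<in> verts H}\<rparr>"

lemma simple_graph_complete: "simple_graph (complete_graph m)"
  by (auto simp: simple_graph_def complete_graph_def)

lemma simple_graph_copies:
  assumes "simple_graph H"
  shows "simple_graph (copies m H)"
proof -
  have "Pair k ` e \<subseteq> {..<m} \<times> verts H \<and> card (Pair k ` e) = 2"
    if "k < m" "e \<in> edges H" for k e
    using assms that by (auto simp: simple_graph_def card_image inj_on_def)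
  then show ?thesis
    using assms by (auto simp: simple_graph_def copies_def)
qed

lemma simple_graph_join:
  assumes "simple_graph G" "simple_graph H"
  shows "simple_graph (graph_join G H)"
proof -
  have "Inl ` e \<subseteq> verts G <+> verts H \<and> card (Inl ` e) = 2" if "e \<in> edges G" for e
    using assms that by (auto simp: simple_graph_def card_image)
  moreover have "Inr ` e \<subseteq> verts G <+> verts H \<and> card (Inr ` e) = 2" if "e \<in> edges H" for e
    using assms that by (auto simp: simple_graph_def card_image)
  moreover have "{Inl v, Inr w} \<subseteq> verts G <+> verts H \<and> card {Inl v, Inr w} = 2"
    if "v \<in> verts G" "w \<in> verts H" for v w
    using that by auto
  moreover have "finite (verts G <+> verts H)"
    using assms by (simp add: simple_graph_def)
  ultimately show ?thesis
    unfolding simple_graph_def graph_join_def ugraph.select_convs by blast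
qed

lemma simple_graph_finite_edges: "simple_graph G \<Longrightarrow> finite (edges G)"
  by (rule finite_subset[of _ "Pow (verts G)"]) (auto simp: simple_graph_def)

text \<open>A join of two nonempty graphs has no isolated vertices, so the normalized Laplacian of
  such a graph does not involve the totalized value \<open>1 / sqrt 0 = 0\<close>.\<close>

lemma vdegree_join_pos:
  assumes "simple_graph G" "simple_graph H" "verts G \<noteq> {}" "verts H \<noteq> {}"
    and "v \<in> verts (graph_join G H)"
  shows "vdegree (graph_join G H) v > 0"
proof -
  have "\<exists>e\<in>edges (graph_join G H). v \<in> e"
  proof (cases v)
    case (Inl x)
    then have "x \<in> verts G" using assms(5) by (auto simp: graph_join_def)
    moreover obtain y where "y \<in> verts H" using assms(4) by blast
    ultimately have "{Inl x, Inr y} \<in> edges (graph_join G H)"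
      unfolding graph_join_def ugraph.select_convs by blast
    then show ?thesis using Inl by blast
  next
    case (Inr y)
    then have "y \<in> verts H" using assms(5) by (auto simp: graph_join_def)
    moreover obtain x where "x \<in> verts G" using assms(3) by blast
    ultimately have "{Inl x, Inr y} \<in> edges (graph_join G H)"
      unfolding graph_join_def ugraph.select_convs by blast
    then show ?thesis using Inr by blast
  qed
  moreover have "finite (edges (graph_join G H))"
    using assms(1,2) by (intro simple_graph_finite_edges simple_graph_join)
  ultimately show ?thesis
    by (auto simp: vdegree_def card_gt_0_iff)
qed

text \<open>The matrices are taken with respect to an enumeration \<open>vs\<close> of the vertices.\<close>

definition adjacency_mat :: "'v ugraph \<Rightarrow> 'v list \<Rightarrow> real mat" where
  "adjacency_mat G vs = mat (length vs) (length vs)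
     (\<lambda>(i, j). if {vs ! i, vs ! j} \<in> edges G then 1 else 0)"

definition degree_mat :: "'v ugraph \<Rightarrow> 'v list \<Rightarrow> real mat" where
  "degree_mat G vs = mat_diag (length vs) (\<lambda>i. real (vdegree G (vs ! i)))"

definition deg_inv_sqrt_mat :: "'v ugraph \<Rightarrow> 'v list \<Rightarrow> real mat" where
  "deg_inv_sqrt_mat G vs = mat_diag (length vs) (\<lambda>i. 1 / sqrt (real (vdegree G (vs ! i))))"

definition norm_laplacian :: "'v ugraph \<Rightarrow> 'v list \<Rightarrow> real mat" where
  "norm_laplacian G vs =
     deg_inv_sqrt_mat G vs * (degree_mat G vs - adjacency_mat G vs) * deg_inv_sqrt_mat G vs"

definition vertex_enum :: "'v ugraph \<Rightarrow> 'v list" where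
  "vertex_enum G = (SOME vs. distinct vs \<and> set vs = verts G)"

text \<open>The eigenvalues with multiplicity are the roots of the characteristic polynomial. The matrix
  is real symmetric, so no eigenvalue is lost by taking only the real roots
  (\<open>size_norm_lap_spectrum\<close>), and the spectrum does not depend on the chosen enumeration
  (\<open>norm_lap_spectrum_eq\<close>).\<close>

definition norm_lap_spectrum :: "'v ugraph \<Rightarrow> real multiset" where
  "norm_lap_spectrum G = proots (char_poly (norm_laplacian G (vertex_enum G)))"

definition norm_lap_energy :: "'v ugraph \<Rightarrow> real" where
  "norm_lap_energy G = (\<Sum>x\<in>#norm_lap_spectrum G. \<bar>x - 1\<bar>)"

definition norm_lap_noncospectral :: "'v ugraph \<Rightarrow> 'w ugraph \<Rightarrow> bool" where
  "norm_lap_noncospectral G H \<longleftrightarrow> norm_lap_spectrum G \<noteq> norm_lap_spectrum H"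

lemma vertex_enum:
  assumes "finite (verts G)"
  shows "distinct (vertex_enum G)" "set (vertex_enum G) = verts G"
proof -
  have "\<exists>vs. distinct vs \<and> set vs = verts G"
    using finite_distinct_list[OF assms] by blast
  from someI_ex[OF this]
  show "distinct (vertex_enum G)" "set (vertex_enum G) = verts G"
    by (auto simp: vertex_enum_def)
qed

lemma norm_laplacian_eq_mat:
  "norm_laplacian G vs = mat (length vs) (length vs) (\<lambda>(i, j).
     1 / sqrt (real (vdegree G (vs ! i))) *
     ((if i = j then real (vdegree G (vs ! i)) else 0) -
      (if {vs ! i, vs ! j} \<in> edges G then 1 else 0)) *
     (1 / sqrt (real (vdegree G (vs ! j)))))"
proof -
  let ?n = "length vs"
  let ?f = "\<lambda>i. 1 / sqrt (real (vdegree G (vs ! i)))"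
  let ?B = "degree_mat G vs - adjacency_mat G vs"
  have B: "?B \<in> carrier_mat ?n ?n"
    by (auto simp: degree_mat_def adjacency_mat_def mat_diag_def)
  have BB: "mat ?n ?n (\<lambda>(i, j). ?f i * ?B $$ (i, j)) \<in> carrier_mat ?n ?n"
    by auto
  show ?thesis
    unfolding norm_laplacian_def deg_inv_sqrt_mat_def mat_diag_mult_left[OF B]
      mat_diag_mult_right[OF BB]
    by (rule eq_matI) (auto simp: degree_mat_def adjacency_mat_def mat_diag_def)
qed

lemma norm_laplacian_carrier: "norm_laplacian G vs \<in> carrier_mat (length vs) (length vs)"
  by (auto simp: norm_laplacian_eq_mat)

lemma norm_laplacian_sym:
  assumes "i < length vs" "j < length vs"
  shows "norm_laplacian G vs $$ (i, j) = norm_laplacian G vs $$ (j, i)"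
  using assms by (auto simp: norm_laplacian_eq_mat insert_commute)

lemma char_poly_permute:
  fixes A B :: "'a :: field mat"
  assumes A: "A \<in> carrier_mat n n" and B: "B \<in> carrier_mat n n"
    and p: "bij_betw p {..<n} {..<n}"
    and AB: "\<And>i j. i < n \<Longrightarrow> j < n \<Longrightarrow> A $$ (i, j) = B $$ (p i, p j)"
  shows "char_poly A = char_poly B"
proof -
  have pn: "p i < n" if "i < n" for i
    using that p by (auto simp: bij_betw_def)
  have pinj: "p i = p j \<longleftrightarrow> i = j" if "i < n" "j < n" for i j
    using that p by (auto simp: bij_betw_def inj_on_def)
  define P :: "'a mat" where "P = mat n n (\<lambda>(i, j). if j = p i then 1 else 0)"
  define Q :: "'a mat" where "Q = mat n n (\<lambda>(i, j). if i = p j then 1 else 0)"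
  have P: "P \<in> carrier_mat n n" and Q: "Q \<in> carrier_mat n n"
    by (auto simp: P_def Q_def)
  have PX: "(P * X) $$ (i, j) = X $$ (p i, j)"
    if "X \<in> carrier_mat n n" "i < n" "j < n" for X i j
  proof -
    have "(P * X) $$ (i, j) = (\<Sum>k\<in>{0..<n}. if k = p i then X $$ (k, j) else 0)"
    proof -
      have "(P * X) $$ (i, j) = (\<Sum>k\<in>{0..<n}. (if k = p i then 1 else 0) * X $$ (k, j))"
        using that by (simp add: P_def scalar_prod_def)
      then show ?thesis by (simp add: if_distrib[of "\<lambda>x. x * _"] cong: if_cong)
    qed
    also have "\<dots> = X $$ (p i, j)"
      using pn[OF that(2)] by simp
    finally show ?thesis .
  qed
  have XQ: "(X * Q) $$ (i, j) = X $$ (i, p j)"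
    if "X \<in> carrier_mat n n" "i < n" "j < n" for X i j
  proof -
    have "(X * Q) $$ (i, j) = (\<Sum>k\<in>{0..<n}. if k = p j then X $$ (i, k) else 0)"
    proof -
      have "(X * Q) $$ (i, j) = (\<Sum>k\<in>{0..<n}. X $$ (i, k) * (if k = p j then 1 else 0))"
        using that by (simp add: Q_def scalar_prod_def)
      then show ?thesis by (simp add: if_distrib[of "\<lambda>x. _ * x"] cong: if_cong)
    qed
    also have "\<dots> = X $$ (i, p j)"
      using pn[OF that(3)] by simp
    finally show ?thesis .
  qed
  have PQ: "P * Q = 1\<^sub>m n"
  proof (rule eq_matI)
    fix i j assume "i < dim_row (1\<^sub>m n :: 'a mat)" "j < dim_col (1\<^sub>m n :: 'a mat)"
    then have ij: "i < n" "j < n" by auto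
    then show "(P * Q) $$ (i, j) = 1\<^sub>m n $$ (i, j)"
      using PX[OF Q ij] pn pinj by (auto simp: Q_def)
  qed (use P Q in auto)
  have A_eq: "A = P * B * Q"
  proof (rule eq_matI)
    fix i j assume "i < dim_row (P * B * Q)" "j < dim_col (P * B * Q)"
    then have ij: "i < n" "j < n" using P Q by auto
    have "P * B \<in> carrier_mat n n" using P B by auto
    from XQ[OF this ij] PX[OF B ij(1) pn[OF ij(2)]] AB[OF ij]
    show "A $$ (i, j) = (P * B * Q) $$ (i, j)" by simp
  qed (use A P Q in auto)
  have "similar_mat A B"
    by (rule similar_matI[OF _ PQ mat_mult_left_right_inverse[OF P Q PQ] A_eq])
      (use A B P Q in auto)
  then show ?thesis by (rule char_poly_similar)
qed

lemma norm_lap_spectrum_eq: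
  assumes "distinct vs" "set vs = verts G"
  shows "norm_lap_spectrum G = proots (char_poly (norm_laplacian G vs))"
proof -
  let ?ws = "vertex_enum G" and ?n = "length vs"
  have fin: "finite (verts G)" using assms(2) by (metis List.finite_set)
  note ws = vertex_enum[OF fin]
  have len: "length ?ws = ?n"
    using assms ws by (metis distinct_card)
  have bv: "bij_betw ((!) vs) {..<?n} (verts G)"
    using assms by (intro bij_betw_nth) auto
  have bw: "bij_betw ((!) ?ws) {..<?n} (verts G)"
    using ws len by (intro bij_betw_nth) auto
  define p where "p = the_inv_into {..<?n} ((!) vs) \<circ> (!) ?ws"
  have p: "bij_betw p {..<?n} {..<?n}"
    unfolding p_def using bw bij_betw_the_inv_into[OF bv] by (rule bij_betw_trans)
  have nth: "vs ! p i = ?ws ! i" if "i < ?n" for i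
    using that bv bw unfolding p_def
    by (auto simp: bij_betw_def intro!: f_the_inv_into_f)
  have pn: "p i < ?n" if "i < ?n" for i
    using that p by (auto simp: bij_betw_def)
  have pinj: "p i = p j \<longleftrightarrow> i = j" if "i < ?n" "j < ?n" for i j
    using that p by (auto simp: bij_betw_def inj_on_def)
  have "char_poly (norm_laplacian G ?ws) = char_poly (norm_laplacian G vs)"
  proof (rule char_poly_permute[OF _ _ p])
    show "norm_laplacian G ?ws \<in> carrier_mat ?n ?n"
      using norm_laplacian_carrier[of G ?ws] len by simp
    show "norm_laplacian G ?ws $$ (i, j) = norm_laplacian G vs $$ (p i, p j)"
      if "i < ?n" "j < ?n" for i j
      using that pn[of i] pn[of j] pinj[of i j] nth[of i] nth[of j]
      by (simp add: norm_laplacian_eq_mat len)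
  qed (rule norm_laplacian_carrier)
  then show ?thesis by (simp add: norm_lap_spectrum_def)
qed

lemma real_symmetric_eigenvalue_real:
  fixes A :: "real mat"
  assumes A: "A \<in> carrier_mat n n"
    and sym: "\<And>i j. i < n \<Longrightarrow> j < n \<Longrightarrow> A $$ (i, j) = A $$ (j, i)"
    and ev: "eigenvalue (map_mat complex_of_real A) z"
  shows "z \<in> \<real>"
proof -
  let ?A = "map_mat complex_of_real A"
  from ev obtain v where v: "v \<in> carrier_vec n" "v \<noteq> 0\<^sub>v n" and Av: "?A *\<^sub>v v = z \<cdot>\<^sub>v v"
    using A by (auto simp: eigenvalue_def eigenvector_def)
  have Avi: "(\<Sum>j<n. of_real (A $$ (i, j)) * v $ j) = z * v $ i" if "i < n" for i
  proof -
    have "(?A *\<^sub>v v) $ i = (\<Sum>j<n. of_real (A $$ (i, j)) * v $ j)"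
      using that A v by (auto simp: scalar_prod_def lessThan_atLeast0 intro!: sum.cong)
    then show ?thesis using Av that v by simp
  qed
  let ?s = "\<Sum>i<n. \<Sum>j<n. cnj (v $ i) * of_real (A $$ (i, j)) * v $ j"
  let ?N = "\<Sum>i<n. (cmod (v $ i))\<^sup>2"
  have "?s = (\<Sum>i<n. cnj (v $ i) * (z * v $ i))"
    by (simp add: Avi[symmetric] sum_distrib_left mult.assoc)
  also have "\<dots> = z * of_real ?N"
    by (simp add: sum_distrib_left complex_norm_square mult_ac flip: of_real_power)
  finally have s: "?s = z * of_real ?N" .
  have "cnj ?s = (\<Sum>i<n. \<Sum>j<n. v $ i * of_real (A $$ (i, j)) * cnj (v $ j))"
    by simp
  also have "\<dots> = (\<Sum>j<n. \<Sum>i<n. v $ i * of_real (A $$ (i, j)) * cnj (v $ j))"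
    by (rule sum.swap)
  also have "\<dots> = ?s"
    by (intro sum.cong refl) (simp add: sym mult_ac)
  finally have "cnj z * of_real ?N = z * of_real ?N"
    using s by simp
  moreover obtain i where i: "i < n" "v $ i \<noteq> 0"
    using v by (metis eq_vecI carrier_vecD index_zero_vec)
  have "(cmod (v $ i))\<^sup>2 \<le> ?N"
    using i by (intro member_le_sum) auto
  with i have "?N \<noteq> 0" by (metis not_le zero_less_norm_iff zero_less_power)
  then have "complex_of_real ?N \<noteq> 0" by (metis of_real_eq_0_iff)
  ultimately show ?thesis by (metis Reals_cnj_iff mult_right_cancel)
qed

lemma map_poly_of_real_mult:
  "map_poly complex_of_real (p * q) = map_poly of_real p * map_poly of_real q"
  by (rule poly_eqI) (simp add: coeff_map_poly coeff_mult)

lemma size_proots_char_poly_real_symmetric: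
  fixes A :: "real mat"
  assumes A: "A \<in> carrier_mat n n"
    and sym: "\<And>i j. i < n \<Longrightarrow> j < n \<Longrightarrow> A $$ (i, j) = A $$ (j, i)"
  shows "size (proots (char_poly A)) = n"
proof -
  let ?A = "map_mat complex_of_real A"
  have cA: "?A \<in> carrier_mat n n" using A by simp
  obtain zs where zs: "char_poly ?A = (\<Prod>z\<leftarrow>zs. [:- z, 1:])" "length zs = n"
    using char_poly_factorized[OF cA] by blast
  have "\<forall>z\<in>set zs. z = of_real (Re z)"
  proof
    fix z assume "z \<in> set zs"
    then have "poly (char_poly ?A) z = 0"
      unfolding zs(1) by (induction zs) auto
    then have "eigenvalue ?A z" using eigenvalue_root_char_poly[OF cA] by simp
    from real_symmetric_eigenvalue_real[OF A sym this]
    show "z = of_real (Re z)" by (simp add: complex_is_Real_iff complex_eq_iff)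
  qed
  then have "(\<Prod>z\<leftarrow>zs. [:- z, 1:]) = map_poly of_real (\<Prod>r\<leftarrow>map Re zs. [:- r, 1:])"
  proof (induction zs)
    case (Cons a zs)
    have "[:- a, 1:] = map_poly of_real [:- Re a, 1:]"
      using Cons.prems by (simp add: map_poly_pCons)
    then have "(\<Prod>z\<leftarrow>a # zs. [:- z, 1:]) =
        map_poly of_real ([:- Re a, 1:] * (\<Prod>r\<leftarrow>map Re zs. [:- r, 1:]))"
      using Cons by (simp only: map_poly_of_real_mult list.map prod_list.Cons) simp
    then show ?case by simp
  qed simp
  moreover have "char_poly ?A = map_poly of_real (char_poly A)"
    by (rule of_real_hom.char_poly_hom[OF A])
  ultimately have "map_poly complex_of_real (char_poly A) =
      map_poly of_real (\<Prod>r\<leftarrow>map Re zs. [:- r, 1:])"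
    using zs(1) by simp
  then have "char_poly A = (\<Prod>r\<leftarrow>map Re zs. [:- r, 1:])"
    by (simp add: poly_eq_iff coeff_map_poly)
  moreover have "proots (\<Prod>r\<leftarrow>rs. [:- r, 1:]) = mset rs" for rs :: "real list"
  proof (induction rs)
    case (Cons r rs)
    have "(\<Prod>r\<leftarrow>rs. [:- r, 1:]) \<noteq> 0"
      by (auto simp: prod_list_zero_iff)
    then have "proots ([:- r, 1:] * (\<Prod>r\<leftarrow>rs. [:- r, 1:])) = {#r#} + mset rs"
      using Cons by (subst proots_mult) (auto simp del: mult_pCons_left)
    then show ?case by simp
  qed simp
  ultimately show ?thesis using zs(2) by (simp only: size_mset length_map)
qed

lemma size_norm_lap_spectrum:
  assumes "finite (verts G)"
  shows "size (norm_lap_spectrum G) = card (verts G)"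
proof -
  let ?vs = "vertex_enum G"
  have "size (norm_lap_spectrum G) = length ?vs"
    unfolding norm_lap_spectrum_def
    by (rule size_proots_char_poly_real_symmetric[OF norm_laplacian_carrier norm_laplacian_sym])
  also have "\<dots> = card (verts G)"
    using distinct_card[OF vertex_enum(1)[OF assms]] vertex_enum(2)[OF assms] by simp
  finally show ?thesis .
qed

end

theory Submission
  imports Defs
begin

text \<open>
  The common mechanism is the spectrum of a join of two regular graphs. If \<open>G\<close> is \<open>r\<close>-regular on
  \<open>m\<close> vertices and \<open>H\<close> is \<open>s\<close>-regular on \<open>n\<close> vertices, then in their join the degrees are
  \<open>d = r + n\<close> and \<open>e = s + m\<close>, and the normalized Laplacian consists of the diagonal blocks
  \<open>I - A\<^sub>G / d\<close> and \<open>I - A\<^sub>H / e\<close> and of constant off-diagonal blocks. The all-ones vectors of the two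
  blocks have eigenvalues \<open>n / d\<close> and \<open>m / e\<close>; the constant blocks couple them, and see nothing of
  the vectors with entry sum zero. The spectrum of the join is therefore that of the two diagonal
  blocks, except that \<open>n / d\<close> and \<open>m / e\<close> give way to \<open>0\<close> and \<open>n / d + m / e\<close>
  (\<open>norm_lap_spectrum_join_regular\<close>). The underlying identity of characteristic polynomials is
  \<open>char_poly_const_blocks\<close>; it comes from factoring out the block diagonal part and evaluating the
  remaining determinant, a perturbation of the identity, by Sylvester's identity.

  The spectra of the diagonal blocks are known for complete graphs
  (\<open>proots_scaled_laplacian_complete_graph\<close>) and hence for disjoint copies of them
  (\<open>char_poly_scaled_laplacian_copies\<close>); \<open>bK\<^sub>1\<close> is a special case. With
  \<open>p = 1 + 1 / (b + 1)\<close> and \<open>q = 1 - 1 / (b + 1)\<close> this yields the eigenvalues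
  \<open>0, p, p, q\<close> for both graphs, and in addition \<open>q + 4 / (b + 3)\<close> and \<open>b - 1\<close> times
  \<open>1 + 1 / (b + 3)\<close> for the join with \<open>K\<^sub>b\<close>, but \<open>q + 1\<close> and \<open>b - 1\<close> times \<open>1\<close> for the join with
  \<open>bK\<^sub>1\<close>. Only the second graph has the eigenvalue \<open>1\<close>. The energies agree because the additional
  eigenvalues have the same total distance from \<open>1\<close>:
  \<open>4 / (b + 3) - 1 / (b + 1) + (b - 1) / (b + 3) = q\<close>.
\<close>

section \<open>Determinants of matrices with constant off-diagonal blocks\<close>

definition const_mat :: "nat \<Rightarrow> nat \<Rightarrow> 'a \<Rightarrow> 'a mat" where
  "const_mat m n c = mat m n (\<lambda>_. c)"

lemma const_mat_carrier [simp]: "const_mat m n c \<in> carrier_mat m n"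
  by (simp add: const_mat_def)

text \<open>The all-ones vector is an eigenvector of a matrix with constant row sums, so such a matrix acts
  on constant matrices as a scalar. This is the only way in which regularity enters the determinant
  computations.\<close>

lemma mult_const_mat:
  fixes X :: "'a :: comm_ring_1 mat"
  assumes "X \<in> carrier_mat m n" and "\<And>i. i < m \<Longrightarrow> (\<Sum>j<n. X $$ (i, j)) = t"
  shows "X * const_mat n k c = const_mat m k (t * c)"
  using assms
  by (intro eq_matI)
    (auto simp: const_mat_def scalar_prod_def lessThan_atLeast0 simp flip: sum_distrib_right)

text \<open>Equating the two evaluations gives Sylvester's identity. They come from multiplying the block
  matrix on the left and on the right by the same unitriangular matrix, which clears the upper right
  block.\<close>

lemma det_identity_blocks:
  fixes U V :: "'a :: idom mat"
  assumes U: "U \<in> carrier_mat m n" and V: "V \<in> carrier_mat n m"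
  shows "det (four_block_mat (1\<^sub>m m) U V (1\<^sub>m n)) = det (1\<^sub>m m - U * V)" (is "det ?M = _")
    and "det (four_block_mat (1\<^sub>m m) U V (1\<^sub>m n)) = det (1\<^sub>m n - V * U)"
proof -
  let ?E = "four_block_mat (1\<^sub>m m) (- U) (0\<^sub>m n m) (1\<^sub>m n)"
  have E: "?E \<in> carrier_mat (m + n) (m + n)" and M: "?M \<in> carrier_mat (m + n) (m + n)"
    by auto
  have detE: "det ?E = 1"
    using U by (subst det_four_block_mat_lower_left_zero[where n = m and m = n]) auto
  have "det ?M = det (?E * ?M)"
    using detE by (simp add: det_mult[OF E M])
  also have "?E * ?M = four_block_mat (1\<^sub>m m - U * V) (0\<^sub>m m n) V (1\<^sub>m n)"
    using U V by (subst mult_four_block_mat[of _ m m _ n _ n]) (auto simp: minus_add_uminus_mat)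
  also have "det \<dots> = det (1\<^sub>m m - U * V)"
    using U V by (subst det_four_block_mat_upper_right_zero[where n = m and m = n]) auto
  finally show "det ?M = det (1\<^sub>m m - U * V)" .
  have "det ?M = det (?M * ?E)"
    using detE by (simp add: det_mult[OF M E])
  also have "?M * ?E = four_block_mat (1\<^sub>m m) (0\<^sub>m m n) V (1\<^sub>m n - V * U)"
    using U V by (subst mult_four_block_mat[of _ m m _ n _ n])
      (auto intro!: cong_four_block_mat eq_matI)
  also have "det \<dots> = det (1\<^sub>m n - V * U)"
    using U V by (subst det_four_block_mat_upper_right_zero[where n = m and m = n]) auto
  finally show "det ?M = det (1\<^sub>m n - V * U)" .
qed

text \<open>A constant matrix is a column times a row, so Sylvester's identity reduces this to a
  \<open>1 \<times> 1\<close> determinant.\<close>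

lemma det_one_minus_const_mat:
  fixes c :: "'a :: idom"
  shows "det (1\<^sub>m n - const_mat n n c) = 1 - of_nat n * c"
proof -
  have "const_mat n n c = const_mat n 1 1 * const_mat 1 n c"
    by (subst mult_const_mat[where t = 1]) (auto simp: const_mat_def)
  then have "det (1\<^sub>m n - const_mat n n c)
      = det (1\<^sub>m 1 - const_mat 1 n c * const_mat n 1 (1 :: 'a))"
    using det_identity_blocks[of "const_mat 1 n c" 1 n "const_mat n 1 1"] by simp
  also have "const_mat 1 n c * const_mat n 1 1 = const_mat 1 1 (of_nat n * c)"
    by (subst mult_const_mat[where t = "of_nat n * c"]) (auto simp: const_mat_def)
  finally show ?thesis
    by (subst (asm) det_single) (auto simp: const_mat_def)
qed

text \<open>Because \<open>X\<close> and \<open>Y\<close> act as scalars on constant matrices, \<open>diag(X, Y)\<close> can be pulled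
  out as a left factor even when \<open>X\<close> or \<open>Y\<close> is singular; what remains has identity diagonal
  blocks and constant off-diagonal blocks.\<close>

lemma det_const_blocks:
  fixes X Y :: "'a :: field mat"
  assumes X: "X \<in> carrier_mat m m" and Y: "Y \<in> carrier_mat n n"
    and rX: "\<And>i. i < m \<Longrightarrow> (\<Sum>j<m. X $$ (i, j)) = s"
    and rY: "\<And>i. i < n \<Longrightarrow> (\<Sum>j<n. Y $$ (i, j)) = t"
    and "s \<noteq> 0" "t \<noteq> 0"
  shows "det (four_block_mat X (const_mat m n c) (const_mat n m c) Y)
    = det X * det Y * (1 - of_nat (m * n) * c\<^sup>2 / (s * t))"
proof -
  let ?U = "const_mat m n (c / s)" and ?V = "const_mat n m (c / t)"
  let ?D = "four_block_mat X (0\<^sub>m m n) (0\<^sub>m n m) Y"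
  let ?W = "four_block_mat (1\<^sub>m m) ?U ?V (1\<^sub>m n)"
  have XU: "X * ?U = const_mat m n c" and YV: "Y * ?V = const_mat n m c"
    using mult_const_mat[OF X rX] mult_const_mat[OF Y rY] \<open>s \<noteq> 0\<close> \<open>t \<noteq> 0\<close> by simp_all
  have VU: "?V * ?U = const_mat n n (of_nat m * c / t * (c / s))"
    by (rule mult_const_mat) (auto simp: const_mat_def)
  have "four_block_mat X (const_mat m n c) (const_mat n m c) Y = ?D * ?W"
    using X Y by (subst mult_four_block_mat[of _ m m _ n _ n])
      (auto simp: XU YV left_mult_zero_mat[OF const_mat_carrier])
  then have "det (four_block_mat X (const_mat m n c) (const_mat n m c) Y) = det ?D * det ?W"
    using X Y by (simp add: det_mult[of _ "m + n"])
  also have "det ?D = det X * det Y"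
    using X Y by (subst det_four_block_mat_lower_left_zero[where n = m and m = n]) auto
  also have "det ?W = 1 - of_nat (m * n) * c\<^sup>2 / (s * t)"
    by (subst det_identity_blocks(2)) (auto simp: VU det_one_minus_const_mat power2_eq_square mult_ac)
  finally show ?thesis .
qed

section \<open>Characteristic polynomials of block matrices\<close>

lemma poly_char_poly:
  fixes A :: "'a :: field mat"
  assumes "A \<in> carrier_mat n n"
  shows "poly (char_poly A) x = det (x \<cdot>\<^sub>m 1\<^sub>m n - A)"
  using assms unfolding char_poly_matrix[OF assms]
  by (intro arg_cong[where f = det] eq_matI) (auto simp: char_matrix_def)

text \<open>Characteristic polynomials are compared by their values below; the finitely many exceptional
  points are those at which the evaluation would divide by zero.\<close>

lemma poly_eqI_cofinite:
  fixes p q :: "'a :: field_char_0 poly"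
  assumes "finite S" and "\<And>x. x \<notin> S \<Longrightarrow> poly p x = poly q x"
  shows "p = q"
proof (rule ccontr)
  assume "p \<noteq> q"
  then have "finite {x. poly (p - q) x = 0}"
    by (intro poly_roots_finite) simp
  moreover have "UNIV - S \<subseteq> {x. poly (p - q) x = 0}"
    using assms by auto
  ultimately show False
    using \<open>finite S\<close> infinite_UNIV_char_0 by (metis Diff_infinite_finite finite_subset)
qed

text \<open>The eigenvalues \<open>s\<close> and \<open>t\<close> of the two all-ones vectors are replaced by the roots of the
  quadratic that describes how the off-diagonal blocks couple these vectors. The equation is cleared
  of denominators.\<close>

lemma char_poly_const_blocks:
  fixes A B :: "'a :: field_char_0 mat"
  assumes A: "A \<in> carrier_mat m m" and B: "B \<in> carrier_mat n n"
    and rA: "\<And>i. i < m \<Longrightarrow> (\<Sum>j<m. A $$ (i, j)) = s"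
    and rB: "\<And>i. i < n \<Longrightarrow> (\<Sum>j<n. B $$ (i, j)) = t"
  shows "char_poly (four_block_mat A (const_mat m n c) (const_mat n m c) B)
      * ([:- s, 1:] * [:- t, 1:])
    = char_poly A * char_poly B * ([:- s, 1:] * [:- t, 1:] - [:of_nat (m * n) * c\<^sup>2:])"
    (is "char_poly ?M * _ = _")
proof (rule poly_eqI_cofinite[of "{s, t}"])
  fix x assume "x \<notin> {s, t}"
  then have nz: "x - s \<noteq> 0" "x - t \<noteq> 0" by auto
  let ?X = "x \<cdot>\<^sub>m 1\<^sub>m m - A" and ?Y = "x \<cdot>\<^sub>m 1\<^sub>m n - B"
  have X: "?X \<in> carrier_mat m m" and Y: "?Y \<in> carrier_mat n n"
    using A B by auto
  have rows: "(\<Sum>j<k. (x \<cdot>\<^sub>m 1\<^sub>m k - C) $$ (i, j)) = x - r"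
    if "C \<in> carrier_mat k k" "i < k" "(\<Sum>j<k. C $$ (i, j)) = r" for C k i r
  proof -
    have "(\<Sum>j<k. (x \<cdot>\<^sub>m 1\<^sub>m k - C) $$ (i, j)) = (\<Sum>j<k. (if i = j then x else 0) - C $$ (i, j))"
      using that by (intro sum.cong) auto
    then show ?thesis
      using that by (simp add: sum_subtractf)
  qed
  have "poly (char_poly ?M) x = det (x \<cdot>\<^sub>m 1\<^sub>m (m + n) - ?M)"
    using A B by (intro poly_char_poly) auto
  also have "x \<cdot>\<^sub>m 1\<^sub>m (m + n) - ?M
      = four_block_mat ?X (const_mat m n (- c)) (const_mat n m (- c)) ?Y"
    using A B by (intro eq_matI) (auto simp: const_mat_def)
  also have "det \<dots> = det ?X * det ?Y * (1 - of_nat (m * n) * (- c)\<^sup>2 / ((x - s) * (x - t)))"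
    using rows[OF A _ rA] rows[OF B _ rB] nz by (intro det_const_blocks[OF X Y]) auto
  finally have "poly (char_poly ?M) x * ((x - s) * (x - t))
      = det ?X * det ?Y
          * ((1 - of_nat (m * n) * c\<^sup>2 / ((x - s) * (x - t))) * ((x - s) * (x - t)))"
    by simp
  also have "(1 - of_nat (m * n) * c\<^sup>2 / ((x - s) * (x - t))) * ((x - s) * (x - t))
      = (x - s) * (x - t) - of_nat (m * n) * c\<^sup>2"
    using nz by (simp add: left_diff_distrib del: of_nat_mult)
  finally have "poly (char_poly ?M) x * ((x - s) * (x - t))
      = det ?X * det ?Y * ((x - s) * (x - t) - of_nat (m * n) * c\<^sup>2)" .
  then show "poly (char_poly ?M * ([:- s, 1:] * [:- t, 1:])) x
      = poly (char_poly A * char_poly B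
          * ([:- s, 1:] * [:- t, 1:] - [:of_nat (m * n) * c\<^sup>2:])) x"
    by (simp add: poly_char_poly[OF A] poly_char_poly[OF B] algebra_simps)
qed simp

lemma char_poly_diag_blocks:
  fixes A B :: "'a :: field_char_0 mat"
  assumes A: "A \<in> carrier_mat m m" and B: "B \<in> carrier_mat n n"
  shows "char_poly (four_block_mat A (0\<^sub>m m n) (0\<^sub>m n m) B) = char_poly A * char_poly B"
    (is "char_poly ?M = _")
proof (rule poly_eqI_cofinite[of "{}"])
  fix x
  have "poly (char_poly ?M) x = det (x \<cdot>\<^sub>m 1\<^sub>m (m + n) - ?M)"
    using A B by (intro poly_char_poly) auto
  also have "x \<cdot>\<^sub>m 1\<^sub>m (m + n) - ?M
      = four_block_mat (x \<cdot>\<^sub>m 1\<^sub>m m - A) (0\<^sub>m m n) (0\<^sub>m n m) (x \<cdot>\<^sub>m 1\<^sub>m n - B)"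
    using A B by (intro eq_matI) auto
  also have "det \<dots> = det (x \<cdot>\<^sub>m 1\<^sub>m m - A) * det (x \<cdot>\<^sub>m 1\<^sub>m n - B)"
    using A B by (intro det_four_block_mat_lower_left_zero) auto
  finally show "poly (char_poly ?M) x = poly (char_poly A * char_poly B) x"
    by (simp add: poly_char_poly[OF A] poly_char_poly[OF B])
qed simp

lemma char_poly_scalar_minus_const_mat:
  fixes a c :: "'a :: field_char_0"
  assumes "n > 0"
  shows "char_poly (a \<cdot>\<^sub>m 1\<^sub>m n - const_mat n n c) = [:- a, 1:] ^ (n - 1) * [:of_nat n * c - a, 1:]"
    (is "char_poly ?M = _")
proof (rule poly_eqI_cofinite[of "{a}"])
  fix x assume "x \<notin> {a}"
  then have nz: "x - a \<noteq> 0" by simp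
  have "poly (char_poly ?M) x = det (x \<cdot>\<^sub>m 1\<^sub>m n - ?M)"
    by (intro poly_char_poly) (auto simp: const_mat_def)
  also have "x \<cdot>\<^sub>m 1\<^sub>m n - ?M = (x - a) \<cdot>\<^sub>m (1\<^sub>m n - const_mat n n (- c / (x - a)))"
    using nz by (intro eq_matI) (auto simp: const_mat_def field_simps)
  also have "det \<dots> = (x - a) ^ n * (1 + of_nat n * c / (x - a))"
    by (simp add: det_one_minus_const_mat) (simp add: const_mat_def)
  also have "\<dots> = (x - a) ^ (n - 1) * (x - a + of_nat n * c)"
    using nz \<open>n > 0\<close> by (cases n) (simp_all add: field_simps)
  finally show "poly (char_poly ?M) x = poly ([:- a, 1:] ^ (n - 1) * [:of_nat n * c - a, 1:]) x"
    by (simp add: poly_power algebra_simps)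
qed simp

section \<open>Degrees and adjacency matrices\<close>

definition regular :: "'v ugraph \<Rightarrow> nat \<Rightarrow> bool" where
  "regular G r \<longleftrightarrow> (\<forall>v\<in>verts G. vdegree G v = r)"

lemma vdegree_eq_card_neighbours:
  assumes "simple_graph G"
  shows "vdegree G v = card {w \<in> verts G. {v, w} \<in> edges G}"
proof -
  have "bij_betw (\<lambda>w. {v, w}) {w \<in> verts G. {v, w} \<in> edges G} {e \<in> edges G. v \<in> e}"
  proof (rule bij_betw_imageI)
    show "inj_on (\<lambda>w. {v, w}) {w \<in> verts G. {v, w} \<in> edges G}"
      by (auto simp: inj_on_def doubleton_eq_iff)
    have "\<exists>w\<in>verts G. e = {v, w}" if "e \<in> edges G" "v \<in> e" for e
    proof -
      have "card e = 2" "e \<subseteq> verts G"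
        using assms that(1) by (auto simp: simple_graph_def)
      with that(2) show ?thesis
        by (auto simp: card_2_iff insert_commute)
    qed
    then show "(\<lambda>w. {v, w}) ` {w \<in> verts G. {v, w} \<in> edges G} = {e \<in> edges G. v \<in> e}"
      by blast
  qed
  then show ?thesis
    by (simp add: vdegree_def bij_betw_same_card)
qed

lemma adjacency_mat_carrier [simp]: "adjacency_mat G vs \<in> carrier_mat (length vs) (length vs)"
  by (simp add: adjacency_mat_def)

text \<open>Together with regularity this supplies the constant row sums that the block determinants need.\<close>

lemma adjacency_mat_row_sum:
  assumes "simple_graph G" "distinct vs" "set vs = verts G" "i < length vs"
  shows "(\<Sum>j<length vs. adjacency_mat G vs $$ (i, j)) = real (vdegree G (vs ! i))"
proof -
  have "(\<Sum>j<length vs. adjacency_mat G vs $$ (i, j))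
      = (\<Sum>j<length vs. if {vs ! i, vs ! j} \<in> edges G then 1 else 0)"
    using assms(4) by (auto simp: adjacency_mat_def)
  also have "\<dots> = (\<Sum>w\<in>verts G. if {vs ! i, w} \<in> edges G then 1 else 0)"
    using assms(2,3) by (intro sum.reindex_bij_betw bij_betw_nth) auto
  also have "\<dots> = real (vdegree G (vs ! i))"
    using assms(1) by (simp add: vdegree_eq_card_neighbours simple_graph_def sum.If_cases Int_def)
  finally show ?thesis .
qed

lemma adjacency_mat_append:
  "adjacency_mat G (vs @ ws) = four_block_mat (adjacency_mat G vs)
     (mat (length vs) (length ws) (\<lambda>(i, j). if {vs ! i, ws ! j} \<in> edges G then 1 else 0))
     (mat (length ws) (length vs) (\<lambda>(i, j). if {ws ! i, vs ! j} \<in> edges G then 1 else 0))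
     (adjacency_mat G ws)"
  by (intro eq_matI) (auto simp: adjacency_mat_def nth_append)

lemma adjacency_mat_map:
  assumes "\<And>v w. v \<in> set vs \<Longrightarrow> w \<in> set vs \<Longrightarrow> {f v, f w} \<in> edges H \<longleftrightarrow> {v, w} \<in> edges G"
  shows "adjacency_mat H (map f vs) = adjacency_mat G vs"
  using assms by (intro eq_matI) (auto simp: adjacency_mat_def)

text \<open>A diagonal block of the normalized Laplacian of a join of regular graphs: \<open>1 / k\<close> will be the
  common degree in the join of the vertices of \<open>G\<close>, which exceeds their degree in \<open>G\<close>.\<close>

definition scaled_laplacian :: "real \<Rightarrow> 'v ugraph \<Rightarrow> 'v list \<Rightarrow> real mat" where
  "scaled_laplacian k G vs = 1\<^sub>m (length vs) - k \<cdot>\<^sub>m adjacency_mat G vs"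

lemma scaled_laplacian_carrier [simp]:
  "scaled_laplacian k G vs \<in> carrier_mat (length vs) (length vs)"
  unfolding scaled_laplacian_def by (intro minus_carrier_mat) simp

lemma scaled_laplacian_row_sum:
  assumes "simple_graph G" "regular G r" "distinct vs" "set vs = verts G" "i < length vs"
  shows "(\<Sum>j<length vs. scaled_laplacian k G vs $$ (i, j)) = 1 - k * real r"
proof -
  have "(\<Sum>j<length vs. scaled_laplacian k G vs $$ (i, j))
      = (\<Sum>j<length vs. (if i = j then 1 else 0) - k * adjacency_mat G vs $$ (i, j))"
    using assms(5) by (intro sum.cong) (auto simp: scaled_laplacian_def adjacency_mat_def)
  also have "\<dots> = 1 - k * real (vdegree G (vs ! i))"
    using assms(5) adjacency_mat_row_sum[OF assms(1,3,4,5)]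
    by (simp add: sum_subtractf flip: sum_distrib_left)
  also have "vdegree G (vs ! i) = r"
    using assms(2,4,5) nth_mem[of i vs] by (auto simp: regular_def)
  finally show ?thesis .
qed

section \<open>Complete graphs\<close>

lemma edge_complete_graph: "{i, j} \<in> edges (complete_graph m) \<longleftrightarrow> i < m \<and> j < m \<and> i \<noteq> j"
  by (auto simp: complete_graph_def doubleton_eq_iff)

lemma verts_complete_graph: "verts (complete_graph m) = {..<m}"
  by (simp add: complete_graph_def)

lemma regular_complete_graph: "regular (complete_graph m) (m - 1)"
proof -
  have "{w \<in> verts (complete_graph m). {v, w} \<in> edges (complete_graph m)} = {..<m} - {v}"
    if "v < m" for v
    using that by (auto simp: edge_complete_graph verts_complete_graph)
  then show ?thesis
    by (auto simp: regular_def verts_complete_graph vdegree_eq_card_neighbours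
        simple_graph_complete)
qed

text \<open>The adjacency matrix is the all-ones matrix minus the identity.\<close>

lemma proots_scaled_laplacian_complete_graph:
  assumes "m > 0"
  shows "proots (char_poly (scaled_laplacian k (complete_graph m) [0..<m]))
    = replicate_mset (m - 1) (1 + k) + {#1 - k * (real m - 1)#}"
proof -
  have "scaled_laplacian k (complete_graph m) [0..<m] = (1 + k) \<cdot>\<^sub>m 1\<^sub>m m - const_mat m m k"
    by (intro eq_matI)
      (auto simp: scaled_laplacian_def adjacency_mat_def const_mat_def edge_complete_graph)
  moreover have "[:a, 1:] \<noteq> 0" for a :: real
    by simp
  ultimately show ?thesis
    using assms
    by (simp add: char_poly_scalar_minus_const_mat proots_mult proots_power algebra_simps
        del: mult_pCons_left mult_pCons_right)
qed

section \<open>Disjoint copies\<close>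

lemma edge_copies:
  "{(i, v), (j, w)} \<in> edges (copies m H) \<longleftrightarrow> i < m \<and> i = j \<and> {v, w} \<in> edges H"
proof
  assume "{(i, v), (j, w)} \<in> edges (copies m H)"
  then obtain k e where k: "k < m" "e \<in> edges H" and e: "{(i, v), (j, w)} = Pair k ` e"
    by (auto simp: copies_def)
  from e have "i = k" "j = k" by auto
  with e have "Pair k ` e = Pair k ` {v, w}" by auto
  then have "e = {v, w}" using inj_image_eq_iff[of "Pair k" e "{v, w}"] by (simp add: inj_on_def)
  with k \<open>i = k\<close> \<open>j = k\<close> show "i < m \<and> i = j \<and> {v, w} \<in> edges H" by simp
next
  assume "i < m \<and> i = j \<and> {v, w} \<in> edges H"
  then have "Pair i ` {v, w} \<in> edges (copies m H)"
    unfolding copies_def ugraph.select_convs by blast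
  with \<open>i < m \<and> i = j \<and> {v, w} \<in> edges H\<close> show "{(i, v), (j, w)} \<in> edges (copies m H)" by simp
qed

lemma verts_copies: "verts (copies m H) = {..<m} \<times> verts H"
  by (simp add: copies_def)

lemma regular_copies:
  assumes "simple_graph H" "regular H r"
  shows "regular (copies m H) r"
proof -
  have "{y \<in> verts (copies m H). {(i, v), y} \<in> edges (copies m H)}
      = Pair i ` {w \<in> verts H. {v, w} \<in> edges H}" if "i < m" for i v
    using that by (auto simp: edge_copies verts_copies)
  then show ?thesis
    using assms
    by (auto simp: regular_def verts_copies vdegree_eq_card_neighbours simple_graph_copies
        card_image inj_on_def)
qed

text \<open>Listing the vertices copy by copy makes the matrix block diagonal with equal blocks. The
  induction is over the first \<open>l\<close> copies inside a fixed graph of \<open>m\<close> copies, so that every step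
  only appends to the vertex list.\<close>

lemma char_poly_scaled_laplacian_copies:
  "char_poly (scaled_laplacian k (copies m H) (List.product [0..<m] ws))
    = char_poly (scaled_laplacian k H ws) ^ m"
proof -
  let ?L = "\<lambda>l. List.product [0..<l] ws"
  have "char_poly (scaled_laplacian k (copies m H) (?L l)) = char_poly (scaled_laplacian k H ws) ^ l"
    if "l \<le> m" for l
    using that
  proof (induction l)
    case 0
    have "scaled_laplacian k (copies m H) (?L 0) \<in> carrier_mat 0 0"
      using scaled_laplacian_carrier[of k "copies m H" "?L 0"] by simp
    then have "degree (char_poly (scaled_laplacian k (copies m H) (?L 0))) = 0
        \<and> coeff (char_poly (scaled_laplacian k (copies m H) (?L 0))) 0 = 1"
      by (rule degree_monic_char_poly)
    then show ?case
      by (auto elim!: degree_eq_zeroE)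
  next
    case (Suc l)
    let ?n = "length (?L l)"
    have split: "?L (Suc l) = ?L l @ map (Pair l) ws"
      by (simp add: product_concat_map)
    have new: "adjacency_mat (copies m H) (map (Pair l) ws) = adjacency_mat H ws"
      using Suc.prems by (intro adjacency_mat_map) (auto simp: edge_copies)
    \<comment> \<open>Earlier vertices lie in copies of index below \<open>l\<close>, hence are not adjacent to copy \<open>l\<close>.\<close>
    have old: "i < l" if "(i, v) = ?L l ! a" "a < ?n" for i v a
      using nth_mem[OF that(2)] unfolding that(1)[symmetric] by simp
    have no_edge: "{?L l ! a, (l, w)} \<notin> edges (copies m H)"
      "{(l, w), ?L l ! a} \<notin> edges (copies m H)" if "a < ?n" for a w
      using old[OF _ that] by (cases "?L l ! a"; force simp: edge_copies)+
    have "scaled_laplacian k (copies m H) (?L (Suc l))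
        = four_block_mat (scaled_laplacian k (copies m H) (?L l)) (0\<^sub>m ?n (length ws))
            (0\<^sub>m (length ws) ?n) (scaled_laplacian k H ws)"
      unfolding scaled_laplacian_def split adjacency_mat_append new
      by (intro eq_matI) (auto simp: no_edge adjacency_mat_def)
    then have "char_poly (scaled_laplacian k (copies m H) (?L (Suc l)))
        = char_poly (scaled_laplacian k (copies m H) (?L l)) * char_poly (scaled_laplacian k H ws)"
      by (simp only: char_poly_diag_blocks[OF scaled_laplacian_carrier scaled_laplacian_carrier])
    then show ?case
      using Suc by (simp add: mult.commute)
  qed
  then show ?thesis by simp
qed

section \<open>Joins of regular graphs\<close>

lemma verts_join: "verts (graph_join G H) = verts G <+> verts H"
  by (simp add: graph_join_def)

lemma edge_join:
  "{Inl v, Inl w} \<in> edges (graph_join G H) \<longleftrightarrow> {v, w} \<in> edges G"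
  "{Inr x, Inr y} \<in> edges (graph_join G H) \<longleftrightarrow> {x, y} \<in> edges H"
  "{Inl v, Inr x} \<in> edges (graph_join G H) \<longleftrightarrow> v \<in> verts G \<and> x \<in> verts H"
  "{Inr x, Inl v} \<in> edges (graph_join G H) \<longleftrightarrow> v \<in> verts G \<and> x \<in> verts H"
proof -
  have l: "{Inl v, Inl w} = Inl ` e \<longleftrightarrow> e = {v, w}" for v w :: 'a and e
    using inj_image_eq_iff[OF inj_Inl, of "{v, w}" e] by auto
  have r: "{Inr v, Inr w} = Inr ` e \<longleftrightarrow> e = {v, w}" for v w :: 'b and e
    using inj_image_eq_iff[OF inj_Inr, of "{v, w}" e] by auto
  show "{Inl v, Inl w} \<in> edges (graph_join G H) \<longleftrightarrow> {v, w} \<in> edges G"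
    by (auto simp: graph_join_def l image_iff doubleton_eq_iff)
  show "{Inr x, Inr y} \<in> edges (graph_join G H) \<longleftrightarrow> {x, y} \<in> edges H"
    by (auto simp: graph_join_def r image_iff doubleton_eq_iff)
  show "{Inl v, Inr x} \<in> edges (graph_join G H) \<longleftrightarrow> v \<in> verts G \<and> x \<in> verts H"
    by (auto simp: graph_join_def doubleton_eq_iff)
  then show "{Inr x, Inl v} \<in> edges (graph_join G H) \<longleftrightarrow> v \<in> verts G \<and> x \<in> verts H"
    by (simp add: insert_commute)
qed

lemma vdegree_join:
  assumes G: "simple_graph G" and H: "simple_graph H"
  shows "v \<in> verts G \<Longrightarrow> vdegree (graph_join G H) (Inl v) = vdegree G v + card (verts H)"
    and "w \<in> verts H \<Longrightarrow> vdegree (graph_join G H) (Inr w) = vdegree H w + card (verts G)"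
proof -
  note deg = vdegree_eq_card_neighbours[OF simple_graph_join[OF G H]]
    vdegree_eq_card_neighbours[OF G] vdegree_eq_card_neighbours[OF H]
  have fin: "finite (verts G)" "finite (verts H)"
    using G H by (auto simp: simple_graph_def)
  show "vdegree (graph_join G H) (Inl v) = vdegree G v + card (verts H)" if "v \<in> verts G"
  proof -
    have "{y \<in> verts (graph_join G H). {Inl v, y} \<in> edges (graph_join G H)}
        = {u \<in> verts G. {v, u} \<in> edges G} <+> verts H"
      using that by (auto simp: verts_join edge_join)
    then show ?thesis
      using fin by (simp add: deg card_Plus)
  qed
  show "vdegree (graph_join G H) (Inr w) = vdegree H w + card (verts G)" if "w \<in> verts H"
  proof -
    have "{y \<in> verts (graph_join G H). {Inr w, y} \<in> edges (graph_join G H)}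
        = verts G <+> {u \<in> verts H. {w, u} \<in> edges H}"
      using that by (auto simp: verts_join edge_join)
    then show ?thesis
      using fin by (simp add: deg card_Plus)
  qed
qed

text \<open>Every vertex of \<open>G\<close> has degree \<open>d\<close> in the join and every vertex of \<open>H\<close> has degree \<open>e\<close>, so
  the conjugation by the inverse square root of the degree matrix scales each block by a constant.\<close>

lemma norm_laplacian_join_regular:
  assumes G: "simple_graph G" "regular G r" "distinct vs" "set vs = verts G" "verts G \<noteq> {}"
    and H: "simple_graph H" "regular H s" "distinct ws" "set ws = verts H" "verts H \<noteq> {}"
  defines "d \<equiv> real (r + length ws)" and "e \<equiv> real (s + length vs)"
  shows "norm_laplacian (graph_join G H) (map Inl vs @ map Inr ws)
    = four_block_mat (scaled_laplacian (1 / d) G vs)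
        (const_mat (length vs) (length ws) (- (1 / sqrt (d * e))))
        (const_mat (length ws) (length vs) (- (1 / sqrt (d * e))))
        (scaled_laplacian (1 / e) H ws)"
proof -
  have pos: "d > 0" "e > 0"
    using G(4,5) H(4,5) by (auto simp: d_def e_def intro!: add_nonneg_pos)
  have card: "card (verts G) = length vs" "card (verts H) = length ws"
    using G(3,4) H(3,4) by (metis distinct_card)+
  have dG: "real (vdegree (graph_join G H) (Inl (vs ! i))) = d" and "vs ! i \<in> verts G"
    if "i < length vs" for i
    using that nth_mem[OF that] G H(1) by (auto simp: vdegree_join card regular_def d_def)
  have dH: "real (vdegree (graph_join G H) (Inr (ws ! i))) = e" and "ws ! i \<in> verts H"
    if "i < length ws" for i
    using that nth_mem[OF that] H G(1) by (auto simp: vdegree_join card regular_def e_def)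
  have scale: "1 / sqrt d * x * (1 / sqrt d) = x / d" "1 / sqrt e * x * (1 / sqrt e) = x / e"
    "1 / sqrt d * x * (1 / sqrt e) = x / sqrt (d * e)"
    "1 / sqrt e * x * (1 / sqrt d) = x / sqrt (d * e)" for x
    using pos by (simp_all add: real_sqrt_mult mult.commute)
  note mems = \<open>\<And>i. i < length vs \<Longrightarrow> vs ! i \<in> verts G\<close> \<open>\<And>i. i < length ws \<Longrightarrow> ws ! i \<in> verts H\<close>
  show ?thesis
    unfolding norm_laplacian_eq_mat
    using pos
    by (intro eq_matI)
      (auto simp: nth_append dG dH mems edge_join scaled_laplacian_def adjacency_mat_def
        const_mat_def scale scale[of 1, unfolded mult_1_right] diff_divide_distrib
        simp del: times_divide_eq_left times_divide_eq_right)
qed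

text \<open>The quadratic factor of the block formula simplifies because the square of the coupling
  constant times the orders of the two graphs is the product \<open>s t\<close> of the two row sums: then
  \<open>(x - s) (x - t) - s t = x (x - (s + t))\<close>. Two eigenvalues are thus exchanged for \<open>0\<close> and
  \<open>s + t\<close>. The exchanged eigenvalues are added on the left, which avoids multiset difference.\<close>

lemma norm_lap_spectrum_join_regular:
  assumes G: "simple_graph G" "regular G r" "distinct vs" "set vs = verts G" "verts G \<noteq> {}"
    and H: "simple_graph H" "regular H s" "distinct ws" "set ws = verts H" "verts H \<noteq> {}"
  defines "d \<equiv> real (r + length ws)" and "e \<equiv> real (s + length vs)"
  shows "norm_lap_spectrum (graph_join G H) + {#length ws / d, length vs / e#}
    = proots (char_poly (scaled_laplacian (1 / d) G vs))
      + proots (char_poly (scaled_laplacian (1 / e) H ws))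
      + {#0, length ws / d + length vs / e#}"
proof -
  let ?m = "length vs" and ?n = "length ws"
  let ?A = "scaled_laplacian (1 / d) G vs" and ?B = "scaled_laplacian (1 / e) H ws"
  let ?M = "norm_laplacian (graph_join G H) (map Inl vs @ map Inr ws)"
  let ?s = "?n / d" and ?t = "?m / e"
  have pos: "d > 0" "e > 0"
    using G(4,5) H(4,5) by (auto simp: d_def e_def intro!: add_nonneg_pos)
  have s: "1 - 1 / d * real r = ?s" and t: "1 - 1 / e * real s = ?t"
    using pos by (auto simp: field_simps d_def e_def)
  have c: "real (?m * ?n) * (- (1 / sqrt (d * e)))\<^sup>2 = ?s * ?t"
    using pos by (simp add: power_divide)
  have "char_poly ?M * ([:- ?s, 1:] * [:- ?t, 1:])
      = char_poly ?A * char_poly ?B * ([:- ?s, 1:] * [:- ?t, 1:] - [:?s * ?t:])"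
    unfolding norm_laplacian_join_regular[OF G H, folded d_def e_def]
    unfolding c[symmetric]
    by (rule char_poly_const_blocks)
      (use scaled_laplacian_row_sum[OF G(1-4), of _ "1 / d"]
        scaled_laplacian_row_sum[OF H(1-4), of _ "1 / e"] in
          \<open>simp_all only: s t scaled_laplacian_carrier\<close>)
  also have "[:- ?s, 1:] * [:- ?t, 1:] - [:?s * ?t:] = [:- 0, 1:] * [:- (?s + ?t), 1:]"
    by simp
  finally have eq: "proots (char_poly ?M * ([:- ?s, 1:] * [:- ?t, 1:]))
      = proots (char_poly ?A * char_poly ?B * ([:- 0, 1:] * [:- (?s + ?t), 1:]))"
    by (rule arg_cong)
  have nz: "char_poly C \<noteq> 0" if "C \<in> carrier_mat k k" for C :: "real mat" and k
    using degree_monic_char_poly[OF that] by auto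
  have lin: "[:a, 1:] \<noteq> 0" for a :: real
    by simp
  have "norm_lap_spectrum (graph_join G H) = proots (char_poly ?M)"
    using G(3,4) H(3,4)
    by (intro norm_lap_spectrum_eq) (auto simp: verts_join distinct_map)
  then show ?thesis
    using eq lin nz[OF norm_laplacian_carrier, of "graph_join G H" "map Inl vs @ map Inr ws"]
      nz[OF scaled_laplacian_carrier, of "1 / d" G vs]
      nz[OF scaled_laplacian_carrier, of "1 / e" H ws]
    by (simp add: proots_mult add.commute add_mset_commute del: mult_pCons_left mult_pCons_right)
qed

section \<open>The two families of joins\<close>

theorem theorem5:
  fixes b :: nat
    and G :: "(nat \<times> nat + nat) ugraph"
    and G' :: "(nat \<times> nat + nat \<times> nat) ugraph"
  assumes "b \<ge> 2"
    and "G = graph_join (copies 2 (complete_graph 2)) (complete_graph b)"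
    and "G' = graph_join (copies 2 (complete_graph 2)) (copies b (complete_graph 1))"
  shows "card (verts G) = b + 4 \<and> card (verts G') = b + 4 \<and>
    norm_lap_noncospectral G G' \<and>
    norm_lap_energy G = norm_lap_energy G' \<and>
    norm_lap_energy G = (2 * real b + 4) / (real b + 1)"
proof -
  let ?P = "copies 2 (complete_graph 2)" and ?Q = "copies b (complete_graph 1)"
  let ?vs = "List.product [0..<2] [0..<2]" and ?ws = "List.product [0..<b] [0..<1]"
  let ?p = "1 + 1 / (real b + 1)" and ?q = "1 - 1 / (real b + 1)"
  note simple = simple_graph_complete simple_graph_copies
  have P: "simple_graph ?P" "regular ?P 1" "distinct ?vs" "set ?vs = verts ?P" "verts ?P \<noteq> {}"
    using regular_copies[OF simple_graph_complete regular_complete_graph[of 2], of 2]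
    by (auto simp: simple distinct_product verts_copies verts_complete_graph lessThan_empty_iff)
  have Q: "simple_graph ?Q" "regular ?Q 0" "distinct ?ws" "set ?ws = verts ?Q" "verts ?Q \<noteq> {}"
    using regular_copies[OF simple_graph_complete regular_complete_graph[of 1], of b] assms(1)
    by (auto simp: simple distinct_product verts_copies verts_complete_graph lessThan_empty_iff)
  have K: "simple_graph (complete_graph b)" "regular (complete_graph b) (b - 1)"
    "distinct [0..<b]" "set [0..<b] = verts (complete_graph b)" "verts (complete_graph b) \<noteq> {}"
    using assms(1) regular_complete_graph[of b]
    by (auto simp: simple verts_complete_graph lessThan_empty_iff)
  have rootsP: "proots (char_poly (scaled_laplacian (1 / (real b + 1)) ?P ?vs)) = {#?p, ?p, ?q, ?q#}"
    unfolding char_poly_scaled_laplacian_copies proots_power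
    by (simp add: proots_scaled_laplacian_complete_graph) (simp add: numeral_2_eq_2 add_mset_commute)
  have rootsQ: "proots (char_poly (scaled_laplacian k ?Q ?ws)) = replicate_mset b 1" for k
    using proots_scaled_laplacian_complete_graph[of 1 k]
    by (simp add: char_poly_scaled_laplacian_copies proots_power
        del: upt_Suc)
  have frac: "real b / (real b + 1) = ?q" "1 - 1 / (real b + 3) * (real b - 1) = 4 / (real b + 3)"
    by (simp_all add: field_simps)
  have len: "length ?vs = 4" "length [0..<b] = b" "length ?ws = b"
    by simp_all
  have deg: "real (1 + b) = real b + 1" "real (b - 1 + 4) = real b + 3"
    using assms(1) by (auto simp: of_nat_diff)
  \<comment> \<open>In both joins the all-ones eigenvalue of the first block is \<open>?q\<close>; that of the second block
    is \<open>4 / (b + 3)\<close> for the complete graph and \<open>1\<close> for the empty graph.\<close>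
  have specG: "norm_lap_spectrum G
      = {#0, ?q + 4 / (real b + 3), ?q, ?p, ?p#} + replicate_mset (b - 1) (1 + 1 / (real b + 3))"
  proof -
    have "b > 0" using assms(1) by simp
    have "norm_lap_spectrum G + {#?q, 4 / (real b + 3)#}
      = {#?p, ?p, ?q, ?q#}
        + (replicate_mset (b - 1) (1 + 1 / (real b + 3)) + {#4 / (real b + 3)#})
        + {#0, ?q + 4 / (real b + 3)#}"
      using norm_lap_spectrum_join_regular[OF P K]
      unfolding assms(2) len deg of_nat_numeral rootsP frac
        proots_scaled_laplacian_complete_graph[OF \<open>b > 0\<close>] .
    then show ?thesis by (simp add: add_mset_commute)
  qed
  have specG': "norm_lap_spectrum G' = {#0, ?q + 1, ?q, ?p, ?p#} + replicate_mset (b - 1) 1"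
  proof -
    have "norm_lap_spectrum G' + {#?q, 1#}
      = {#?p, ?p, ?q, ?q#} + replicate_mset b 1 + {#0, ?q + 1#}"
      using norm_lap_spectrum_join_regular[OF P Q]
      unfolding assms(3) len deg of_nat_numeral rootsP rootsQ frac by simp
    moreover have "replicate_mset b (1 :: real) = add_mset 1 (replicate_mset (b - 1) 1)"
      using assms(1) by (cases b) auto
    ultimately show ?thesis by (simp add: add_mset_commute)
  qed
  \<comment> \<open>The vectors with entry sum zero on the \<open>b\<close> independent vertices have the eigenvalue \<open>1\<close> in
    \<open>G'\<close>; nonzero ones exist because \<open>b \<ge> 2\<close>.\<close>
  have "count (norm_lap_spectrum G) 1 = 0" "count (norm_lap_spectrum G') 1 > 0"
    using assms(1) by (auto simp: specG specG' field_simps)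
  then have "norm_lap_noncospectral G G'"
    unfolding norm_lap_noncospectral_def by (metis less_irrefl)
  moreover have "norm_lap_energy G = (2 * real b + 4) / (real b + 1)"
  proof -
    have "4 / (real b + 3) - 1 / (real b + 1) \<ge> 0"
      by (simp add: field_simps)
    then have "\<bar>?q + 4 / (real b + 3) - 1\<bar> = 4 / (real b + 3) - 1 / (real b + 1)"
      by simp
    then have "norm_lap_energy G = 1 + (4 / (real b + 3) - 1 / (real b + 1)) + 3 / (real b + 1)
        + (real b - 1) / (real b + 3)"
      using assms(1) by (simp add: norm_lap_energy_def specG of_nat_diff)
    also have "\<dots> = 1 + (4 / (real b + 3) + (real b - 1) / (real b + 3)) + 2 / (real b + 1)"
      by (simp add: algebra_simps)
    also have "4 / (real b + 3) + (real b - 1) / (real b + 3) = 1"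
      by (simp flip: add_divide_distrib)
    also have "1 + 1 + 2 / (real b + 1) = (2 * real b + 4) / (real b + 1)"
      by (simp add: field_simps)
    finally show ?thesis .
  qed
  moreover have "norm_lap_energy G' = (2 * real b + 4) / (real b + 1)"
  proof -
    have "?q \<ge> 0" by (simp add: field_simps)
    then have "norm_lap_energy G' = 1 + ?q + 3 / (real b + 1)"
      by (simp add: norm_lap_energy_def specG')
    also have "\<dots> = 1 + 1 + 2 / (real b + 1)"
      by (simp add: algebra_simps)
    also have "\<dots> = (2 * real b + 4) / (real b + 1)"
      by (simp add: field_simps)
    finally show ?thesis .
  qed
  moreover have "card (verts G) = b + 4" "card (verts G') = b + 4"
    by (auto simp: assms(2,3) verts_join verts_copies verts_complete_graph card_Plus)
  ultimately show ?thesis by simp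
qed

end
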